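(* Let $n\ge 0$, let $\theta\in\mathbb{R}$, and let $A$ be a unitary operator on $(n+1)$ qubits such that $$A|0\rangle_{n+1}=\cos\theta\,|\psi_0\rangle_n|0\rangle+\sin\theta\,|\psi_1\rangle_n|1\rangle ,$$ where $|\psi_0\rangle_n,|\psi_1\rangle_n$ are normalized $n$-qubit states. Let $Q=U_0A^\dagger U_fA$ with $U_0=-\mathbf{I}_{n+1}+2|0\rangle_{n+1}\langle 0|_{n+1}$ and $U_f=-\mathbf{I}_{n+1}+2\,\mathbf{I}_n\otimes|0\rangle\langle 0|$. Define $$|\phi\rangle_{n+1}=A^\dagger\left(-\sin\theta\,|\psi_0\rangle_n|0\rangle+\cos\theta\,|\psi_1\rangle_n|1\rangle\right).$$ Then for every integer $m\ge 0$, $$Q^m|0\rangle_{n+1}=\cos(2m\theta)\,|0\rangle_{n+1}+\sin(2m\theta)\,|\phi\rangle_{n+1},$$ and, if $\sin 2\theta\ne 0$, $|\phi\rangle_{n+1}=\frac{1}{\sin 2\theta}\left(Q-\cos 2\theta\,\mathbf{I}_{n+1}\right)|0\rangle_{n+1}$.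
   Context: $\mathbf{I}_k$ is the identity operator on $(\mathbb{C}^2)^{\otimes k}$, and $|0\rangle_{n+1}$ is the all-zero computational basis state of $n+1$ qubits. In $|\psi_i\rangle_n|i\rangle$ the last factor is the last (ancilla) qubit, and $\mathbf{I}_n\otimes|0\rangle\langle 0|$ projects that last qubit onto $|0\rangle$. *)

theory Defs
  imports Complex_Main "Jordan_Normal_Form.Schur_Decomposition"
begin

text \<open>
  The space of \<open>k\<close> qubits is \<open>carrier_vec (2 ^ k)\<close> over the complex numbers.  Tensor products are
  Kronecker products with the right factor varying fastest, so in the computational basis state
  with index \<open>i\<close> the last qubit is \<open>i mod 2\<close>.
\<close>

definition tensor_vec :: "complex vec \<Rightarrow> complex vec \<Rightarrow> complex vec"  (infixl \<open>\<otimes>\<^sub>v\<close> 72) where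
  "u \<otimes>\<^sub>v v = vec (dim_vec u * dim_vec v)
     (\<lambda>i. u $ (i div dim_vec v) * v $ (i mod dim_vec v))"

definition tensor_mat :: "complex mat \<Rightarrow> complex mat \<Rightarrow> complex mat"  (infixl \<open>\<otimes>\<^sub>m\<close> 72) where
  "A \<otimes>\<^sub>m B = mat (dim_row A * dim_row B) (dim_col A * dim_col B)
     (\<lambda>(i, j). A $$ (i div dim_row B, j div dim_col B) * B $$ (i mod dim_row B, j mod dim_col B))"

definition basis_ket :: "nat \<Rightarrow> nat \<Rightarrow> complex vec" where
  "basis_ket k i = unit_vec (2 ^ k) i"

definition ket_bra :: "complex vec \<Rightarrow> complex vec \<Rightarrow> complex mat" where
  "ket_bra u v = mat (dim_vec u) (dim_vec v) (\<lambda>(i, j). u $ i * conjugate (v $ j))"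

definition id_op :: "nat \<Rightarrow> complex mat" where
  "id_op k = 1\<^sub>m (2 ^ k)"

definition normalized_state :: "nat \<Rightarrow> complex vec \<Rightarrow> bool" where
  "normalized_state k v \<longleftrightarrow> v \<in> carrier_vec (2 ^ k) \<and> v \<bullet>c v = 1"

definition unitary_op :: "nat \<Rightarrow> complex mat \<Rightarrow> bool" where
  "unitary_op k A \<longleftrightarrow> A \<in> carrier_mat (2 ^ k) (2 ^ k) \<and>
     mat_adjoint A * A = id_op k \<and> A * mat_adjoint A = id_op k"

definition U_zero :: "nat \<Rightarrow> complex mat" where
  "U_zero n = - id_op (n + 1) + 2 \<cdot>\<^sub>m ket_bra (basis_ket (n + 1) 0) (basis_ket (n + 1) 0)"

definition U_f :: "nat \<Rightarrow> complex mat" where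
  "U_f n = - id_op (n + 1) + 2 \<cdot>\<^sub>m (id_op n \<otimes>\<^sub>m ket_bra (basis_ket 1 0) (basis_ket 1 0))"

end

(* Put a = psi_0|0> and b = psi_1|1>, which are orthonormal.  U_f fixes a and negates b, and A maps
   |0> and phi to the rotated orthonormal pair cos a + sin b and - sin a + cos b.  Hence A^* U_f A is
   a reflection of the plane spanned by |0> and phi, and U_0 is the reflection of that plane which
   fixes |0> and negates phi; their product Q is a rotation by the angle 2 theta. *)
theory Submission
  imports Defs
begin

section \<open>Kronecker products and their inner products\<close>

lemma dim_tensor_vec [simp]: "dim_vec (u \<otimes>\<^sub>v v) = dim_vec u * dim_vec v"
  by (simp add: tensor_vec_def)

lemma dim_tensor_mat [simp]:
  "dim_row (A \<otimes>\<^sub>m B) = dim_row A * dim_row B"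
  "dim_col (A \<otimes>\<^sub>m B) = dim_col A * dim_col B"
  by (simp_all add: tensor_mat_def)

lemma div_mod_less_mult:
  fixes i m n :: nat
  assumes "i < m * n"
  shows "i div n < m" "i mod n < n"
  using assms by (simp_all add: less_mult_imp_div_less) (cases n; simp)

text \<open>Division by \<open>n\<close> identifies the indices below \<open>m * n\<close> with
  pairs: cut into \<open>m\<close> blocks of length \<open>n\<close>, the quotient is constant on
  each block and the remainder runs through \<open>0..<n\<close>.\<close>

lemma sum_div_mod_product:
  fixes f g :: "nat \<Rightarrow> 'a::comm_semiring_0"
  shows "(\<Sum>i<m * n. f (i div n) * g (i mod n)) = (\<Sum>i<m. f i) * (\<Sum>j<n. g j)"
proof -
  have "(\<Sum>i<m * n. f (i div n) * g (i mod n)) =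
      (\<Sum>k<m. \<Sum>i=k * n..<k * n + n. f (i div n) * g (i mod n))"
    by (rule sum.nat_group [symmetric])
  also have "\<dots> = (\<Sum>k<m. \<Sum>j<n. f k * g j)"
  proof (rule sum.cong [OF refl])
    fix k
    have "(\<Sum>i=k * n..<k * n + n. f (i div n) * g (i mod n)) =
        (\<Sum>j=0..<n. f ((j + k * n) div n) * g ((j + k * n) mod n))"
      using sum.shift_bounds_nat_ivl
        [of "\<lambda>i. f (i div n) * g (i mod n)" 0 "k * n" n] by (simp add: add.commute)
    also have "\<dots> = (\<Sum>j<n. f k * g j)"
      unfolding lessThan_atLeast0 by (intro sum.cong) auto
    finally show "(\<Sum>i=k * n..<k * n + n. f (i div n) * g (i mod n)) = (\<Sum>j<n. f k * g j)" .
  qed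
  finally show ?thesis
    by (simp add: sum_product)
qed

text \<open>Kept free of conjugation because it serves twice: for the Hermitian product, once
  \<open>conjugate\<close> is pulled through the tensor, and for matrix-vector products, whose
  entries are unconjugated products with rows.\<close>

lemma scalar_prod_tensor_vec:
  assumes "dim_vec u = dim_vec u'" "dim_vec v = dim_vec v'"
  shows "(u \<otimes>\<^sub>v v) \<bullet> (u' \<otimes>\<^sub>v v') = (u \<bullet> u') * (v \<bullet> v')"
proof -
  have "(u \<otimes>\<^sub>v v) \<bullet> (u' \<otimes>\<^sub>v v') = (\<Sum>i<dim_vec u' * dim_vec v'.
      (u $ (i div dim_vec v') * u' $ (i div dim_vec v')) *
      (v $ (i mod dim_vec v') * v' $ (i mod dim_vec v')))"
    using assms by (simp add: scalar_prod_def tensor_vec_def lessThan_atLeast0 mult_ac)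
  also have "\<dots> = (u \<bullet> u') * (v \<bullet> v')"
    by (subst sum_div_mod_product) (simp add: scalar_prod_def lessThan_atLeast0)
  finally show ?thesis .
qed

lemma conjugate_tensor_vec: "conjugate (u \<otimes>\<^sub>v v) = conjugate u \<otimes>\<^sub>v conjugate v"
  by (intro eq_vecI) (auto simp: tensor_vec_def div_mod_less_mult)

lemma cscalar_prod_tensor_vec:
  assumes "dim_vec u = dim_vec u'" "dim_vec v = dim_vec v'"
  shows "(u \<otimes>\<^sub>v v) \<bullet>c (u' \<otimes>\<^sub>v v') = (u \<bullet>c u') * (v \<bullet>c v')"
  using assms by (simp add: conjugate_tensor_vec scalar_prod_tensor_vec)

lemma row_tensor_mat:
  assumes "i < dim_row A * dim_row B"
  shows "row (A \<otimes>\<^sub>m B) i = row A (i div dim_row B) \<otimes>\<^sub>v row B (i mod dim_row B)"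
  using assms by (intro eq_vecI) (auto simp: tensor_mat_def tensor_vec_def div_mod_less_mult)

text \<open>Each row of a Kronecker product is the tensor of two rows, so every entry of the left
  side is an inner product of two tensors and factors.\<close>

lemma tensor_mat_mult_tensor_vec:
  assumes "dim_col A = dim_vec u" "dim_col B = dim_vec v"
  shows "(A \<otimes>\<^sub>m B) *\<^sub>v (u \<otimes>\<^sub>v v) = (A *\<^sub>v u) \<otimes>\<^sub>v (B *\<^sub>v v)"
proof (rule eq_vecI)
  fix i assume "i < dim_vec ((A *\<^sub>v u) \<otimes>\<^sub>v (B *\<^sub>v v))"
  then have i: "i < dim_row A * dim_row B" by simp
  show "((A \<otimes>\<^sub>m B) *\<^sub>v (u \<otimes>\<^sub>v v)) $ i = ((A *\<^sub>v u) \<otimes>\<^sub>v (B *\<^sub>v v)) $ i"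
    \<comment> \<open>The inner product has to factor while both vectors are still visibly tensors;
      only then is \<open>tensor_vec_def\<close> unfolded, for the right side.\<close>
    using i assms by (simp add: row_tensor_mat scalar_prod_tensor_vec div_mod_less_mult)
      (simp add: tensor_vec_def div_mod_less_mult)
qed simp

section \<open>Rank-one operators, adjoints and reflections\<close>

lemma ket_bra_carrier [simp]: "ket_bra u v \<in> carrier_mat (dim_vec u) (dim_vec v)"
  by (simp add: ket_bra_def)

text \<open>The product \<open>\<bullet>c\<close> conjugates its second argument, so the vector of
  the bra stands second.\<close>

lemma ket_bra_mult_vec:
  assumes "dim_vec w = dim_vec v"
  shows "ket_bra u v *\<^sub>v w = (w \<bullet>c v) \<cdot>\<^sub>v u"
  using assms
  by (intro eq_vecI)
    (auto simp: ket_bra_def scalar_prod_def sum_distrib_left sum_distrib_right mult_ac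
      intro!: sum.cong)

lemma mat_adjoint_carrier [simp]:
  "A \<in> carrier_mat nr nc \<Longrightarrow> mat_adjoint A \<in> carrier_mat nc nr"
  by (auto simp: mat_adjoint_def)

text \<open>Both sides are one double sum over the entries of \<open>A\<close>, in the two orders of
  summation. It reduces the orthogonality of \<phi> and the zero ket to a computation with their
  images under \<open>A\<close>.\<close>

lemma cscalar_prod_mat_adjoint:
  assumes A: "A \<in> carrier_mat nr nc" and u: "u \<in> carrier_vec nr" and v: "v \<in> carrier_vec nc"
  shows "(mat_adjoint A *\<^sub>v u) \<bullet>c v = u \<bullet>c (A *\<^sub>v v)"
proof -
  have "(mat_adjoint A *\<^sub>v u) \<bullet>c v =
      (\<Sum>j<nc. \<Sum>i<nr. conjugate (A $$ (i, j)) * u $ i * conjugate (v $ j))"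
    using A u v
    by (simp add: mat_adjoint_def scalar_prod_def lessThan_atLeast0 sum_distrib_right)
  also have "\<dots> = (\<Sum>i<nr. \<Sum>j<nc. conjugate (A $$ (i, j)) * u $ i * conjugate (v $ j))"
    by (rule sum.swap)
  also have "\<dots> = u \<bullet>c (A *\<^sub>v v)"
    using A u v
    by (simp add: scalar_prod_def lessThan_atLeast0 sum_distrib_left sum_conjugate
        conjugate_dist_mul mult_ac)
  finally show ?thesis .
qed

text \<open>The common shape of \<open>U_zero\<close> and \<open>U_f\<close>, where \<open>P\<close>
  becomes the projection onto the zero ket or onto ancilla zero.\<close>

lemma reflection_mult_vec:
  assumes P: "P \<in> carrier_mat n n" and v: "v \<in> carrier_vec n"
  shows "(- 1\<^sub>m n + (2::complex) \<cdot>\<^sub>m P) *\<^sub>v v = - v + 2 \<cdot>\<^sub>v (P *\<^sub>v v)"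
proof -
  have "(- 1\<^sub>m n + (2::complex) \<cdot>\<^sub>m P) *\<^sub>v v = (- 1\<^sub>m n) *\<^sub>v v + (2 \<cdot>\<^sub>m P) *\<^sub>v v"
    using P v by (intro add_mult_distrib_mat_vec) auto
  also have "(- 1\<^sub>m n) *\<^sub>v v = - v"
    using v by simp
  also have "(2 \<cdot>\<^sub>m P) *\<^sub>v v = 2 \<cdot>\<^sub>v (P *\<^sub>v v)"
    using P v by (intro eq_vecI) auto
  finally show ?thesis .
qed

section \<open>Basis kets and the action of \<open>U_zero\<close> and \<open>U_f\<close>\<close>

lemma basis_ket_carrier [simp]: "basis_ket k i \<in> carrier_vec (2 ^ k)"
  by (simp add: basis_ket_def)

lemma dim_basis_ket [simp]: "dim_vec (basis_ket k i) = 2 ^ k"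
  by (simp add: basis_ket_def)

lemma cscalar_prod_basis_ket:
  assumes "i < 2 ^ k" "j < 2 ^ k"
  shows "basis_ket k i \<bullet>c basis_ket k j = (if i = j then 1 else 0)"
proof -
  have "conjugate (basis_ket k j) = basis_ket k j"
    by (intro eq_vecI) (auto simp: basis_ket_def unit_vec_def)
  then show ?thesis
    using assms by (simp add: basis_ket_def)
qed

lemma U_zero_carrier [simp]: "U_zero n \<in> carrier_mat (2 ^ (n + 1)) (2 ^ (n + 1))"
  by (simp add: U_zero_def id_op_def ket_bra_def)

lemma U_f_carrier [simp]: "U_f n \<in> carrier_mat (2 ^ (n + 1)) (2 ^ (n + 1))"
  by (auto simp: U_f_def id_op_def ket_bra_def)

lemma U_zero_mult_vec:
  assumes "v \<in> carrier_vec (2 ^ (n + 1))"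
  shows "U_zero n *\<^sub>v v = - v + 2 \<cdot>\<^sub>v ((v \<bullet>c basis_ket (n + 1) 0) \<cdot>\<^sub>v basis_ket (n + 1) 0)"
proof -
  have "ket_bra (basis_ket (n + 1) 0) (basis_ket (n + 1) 0)
      \<in> carrier_mat (2 ^ (n + 1)) (2 ^ (n + 1))"
    by (metis ket_bra_carrier dim_basis_ket)
  then show ?thesis
    unfolding U_zero_def id_op_def using assms
    by (subst reflection_mult_vec) (auto simp: ket_bra_mult_vec)
qed

text \<open>The projection in \<open>U_f\<close> touches only the ancilla: it keeps ancilla 0 and
  kills ancilla 1, so twice the projection minus the identity has eigenvalues 1 and -1 on these
  states.\<close>

lemma U_f_mult_tensor_basis_ket:
  assumes "\<psi> \<in> carrier_vec (2 ^ n)" "i < 2"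
  shows "U_f n *\<^sub>v (\<psi> \<otimes>\<^sub>v basis_ket 1 i) =
    (if i = 0 then \<psi> \<otimes>\<^sub>v basis_ket 1 i else - (\<psi> \<otimes>\<^sub>v basis_ket 1 i))"
proof -
  let ?P = "id_op n \<otimes>\<^sub>m ket_bra (basis_ket 1 0) (basis_ket 1 0)"
  \<comment> \<open>The overlap of the ancilla with the zero ket. For \<open>i = 1\<close> the
    projected ancilla \<open>?c \<cdot>\<^sub>v basis_ket 1 0\<close> is the zero vector.\<close>
  let ?c = "if i = 0 then 1 else 0 :: complex"
  have P: "?P \<in> carrier_mat (2 ^ (n + 1)) (2 ^ (n + 1))"
    by (auto simp: id_op_def ket_bra_def)
  have v: "\<psi> \<otimes>\<^sub>v basis_ket 1 i \<in> carrier_vec (2 ^ (n + 1))"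
    using assms by (intro carrier_vecI) simp
  have "?P *\<^sub>v (\<psi> \<otimes>\<^sub>v basis_ket 1 i) =
      (id_op n *\<^sub>v \<psi>) \<otimes>\<^sub>v (ket_bra (basis_ket 1 0) (basis_ket 1 0) *\<^sub>v basis_ket 1 i)"
    using assms by (intro tensor_mat_mult_tensor_vec) (auto simp: id_op_def ket_bra_def)
  also have "\<dots> = \<psi> \<otimes>\<^sub>v (?c \<cdot>\<^sub>v basis_ket 1 0)"
    using assms by (simp add: id_op_def ket_bra_mult_vec cscalar_prod_basis_ket)
  finally have "?P *\<^sub>v (\<psi> \<otimes>\<^sub>v basis_ket 1 i) = \<psi> \<otimes>\<^sub>v (?c \<cdot>\<^sub>v basis_ket 1 0)" .
  then have "U_f n *\<^sub>v (\<psi> \<otimes>\<^sub>v basis_ket 1 i) =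
      - (\<psi> \<otimes>\<^sub>v basis_ket 1 i) + 2 \<cdot>\<^sub>v (\<psi> \<otimes>\<^sub>v (?c \<cdot>\<^sub>v basis_ket 1 0))"
    unfolding U_f_def id_op_def using reflection_mult_vec [OF P v] by (simp add: id_op_def)
  then show ?thesis
    by (auto simp: tensor_vec_def div_mod_less_mult intro!: eq_vecI)
qed

text \<open>The two claims are proved together, since \<open>Q\<close> mixes \<open>x\<close> and
  \<open>y\<close> and each induction step needs both images under the previous power.\<close>

lemma rotation_pow_mat_mult_vec:
  fixes Q :: "complex mat" and \<alpha> :: real
  assumes Q: "Q \<in> carrier_mat d d" and x: "x \<in> carrier_vec d" and y: "y \<in> carrier_vec d"
    and Qx: "Q *\<^sub>v x = complex_of_real (cos \<alpha>) \<cdot>\<^sub>v x + complex_of_real (sin \<alpha>) \<cdot>\<^sub>v y"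
    and Qy: "Q *\<^sub>v y = complex_of_real (- sin \<alpha>) \<cdot>\<^sub>v x + complex_of_real (cos \<alpha>) \<cdot>\<^sub>v y"
  shows "(Q ^\<^sub>m m) *\<^sub>v x =
      complex_of_real (cos (real m * \<alpha>)) \<cdot>\<^sub>v x + complex_of_real (sin (real m * \<alpha>)) \<cdot>\<^sub>v y \<and>
    (Q ^\<^sub>m m) *\<^sub>v y =
      complex_of_real (- sin (real m * \<alpha>)) \<cdot>\<^sub>v x + complex_of_real (cos (real m * \<alpha>)) \<cdot>\<^sub>v y"
proof (induction m)
  case 0
  show ?case
    using Q x y by auto
next
  case (Suc m)
  have Qm: "Q ^\<^sub>m m \<in> carrier_mat d d"
    using Q by simp
  \<comment> \<open>One factor is split off on the right: \<open>Q\<close> first turns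
    \<open>x\<close> or \<open>y\<close> into a combination of both, and linearity then brings in
    the induction hypothesis. The addition formulas finish.\<close>
  have step: "(Q ^\<^sub>m Suc m) *\<^sub>v z = (Q ^\<^sub>m m) *\<^sub>v (Q *\<^sub>v z)" if "z \<in> carrier_vec d" for z
    using that Q Qm by (simp add: assoc_mult_mat_vec [OF Qm Q])
  have lin: "(Q ^\<^sub>m m) *\<^sub>v (a \<cdot>\<^sub>v x + b \<cdot>\<^sub>v y) =
      a \<cdot>\<^sub>v ((Q ^\<^sub>m m) *\<^sub>v x) + b \<cdot>\<^sub>v ((Q ^\<^sub>m m) *\<^sub>v y)" for a b
    using Qm x y by (simp add: mult_add_distrib_mat_vec mult_mat_vec)
  have angle: "real (Suc m) * \<alpha> = real m * \<alpha> + \<alpha>"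
    by (simp add: algebra_simps)
  show ?case
    unfolding step [OF x] step [OF y] Qx Qy lin Suc.IH [THEN conjunct1] Suc.IH [THEN conjunct2]
      angle cos_add sin_add
    using x y by (auto intro!: eq_vecI simp: algebra_simps)
qed

section \<open>The operator \<open>Q\<close> as a rotation by 2\<theta>\<close>

theorem mainTheorem1:
  fixes n :: nat and \<theta> :: real
    and A Q :: "complex mat" and \<psi>0 \<psi>1 \<phi> :: "complex vec"
  assumes A_unitary: "unitary_op (n + 1) A"
    and psi0: "normalized_state n \<psi>0"
    and psi1: "normalized_state n \<psi>1"
    and A_zero: "A *\<^sub>v basis_ket (n + 1) 0 =
      complex_of_real (cos \<theta>) \<cdot>\<^sub>v (\<psi>0 \<otimes>\<^sub>v basis_ket 1 0) +
      complex_of_real (sin \<theta>) \<cdot>\<^sub>v (\<psi>1 \<otimes>\<^sub>v basis_ket 1 1)"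
    and Q_def: "Q = U_zero n * mat_adjoint A * U_f n * A"
    and phi_def: "\<phi> = mat_adjoint A *\<^sub>v
      (complex_of_real (- sin \<theta>) \<cdot>\<^sub>v (\<psi>0 \<otimes>\<^sub>v basis_ket 1 0) +
       complex_of_real (cos \<theta>) \<cdot>\<^sub>v (\<psi>1 \<otimes>\<^sub>v basis_ket 1 1))"
  shows "(\<forall>m::nat. (Q ^\<^sub>m m) *\<^sub>v basis_ket (n + 1) 0 =
      complex_of_real (cos (2 * real m * \<theta>)) \<cdot>\<^sub>v basis_ket (n + 1) 0 +
      complex_of_real (sin (2 * real m * \<theta>)) \<cdot>\<^sub>v \<phi>) \<and>
    (sin (2 * \<theta>) \<noteq> 0 \<longrightarrow>
      \<phi> = complex_of_real (1 / sin (2 * \<theta>)) \<cdot>\<^sub>v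
        ((Q - complex_of_real (cos (2 * \<theta>)) \<cdot>\<^sub>m id_op (n + 1)) *\<^sub>v basis_ket (n + 1) 0))"
proof -
  let ?d = "2 ^ (n + 1) :: nat"
  define z where "z = basis_ket (n + 1) 0"
  define a where "a = \<psi>0 \<otimes>\<^sub>v basis_ket 1 0"
  define b where "b = \<psi>1 \<otimes>\<^sub>v basis_ket 1 1"
  define c where "c = complex_of_real (cos \<theta>)"
  define s where "s = complex_of_real (sin \<theta>)"
  \<comment> \<open>The partner of \<open>A *\<^sub>v z\<close> in the pair \<open>a\<close>,
    \<open>b\<close> turned by \<theta>; it turns out to be the image of \<phi> under
    \<open>A\<close>.\<close>
  define w where "w = (- s) \<cdot>\<^sub>v a + c \<cdot>\<^sub>v b"
  have A: "A \<in> carrier_mat ?d ?d" and AA: "mat_adjoint A * A = 1\<^sub>m ?d" "A * mat_adjoint A = 1\<^sub>m ?d"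
    using A_unitary by (auto simp: unitary_op_def id_op_def)
  note A' = mat_adjoint_carrier [OF A]
  have \<psi>0: "\<psi>0 \<in> carrier_vec (2 ^ n)" "\<psi>0 \<bullet>c \<psi>0 = 1"
    and \<psi>1: "\<psi>1 \<in> carrier_vec (2 ^ n)" "\<psi>1 \<bullet>c \<psi>1 = 1"
    using psi0 psi1 by (auto simp: normalized_state_def)
  have z: "z \<in> carrier_vec ?d"
    unfolding z_def by (rule basis_ket_carrier)
  have a: "a \<in> carrier_vec ?d" and b: "b \<in> carrier_vec ?d"
    using \<psi>0 \<psi>1 by (auto simp: a_def b_def intro!: carrier_vecI)
  have w: "w \<in> carrier_vec ?d"
    using a b by (simp add: w_def)
  \<comment> \<open>Orthogonality of \<open>a\<close> and \<open>b\<close> comes from the ancilla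
    factors alone; \<psi>0 and \<psi>1 may overlap.\<close>
  have ip: "a \<bullet>c a = 1" "b \<bullet>c b = 1" "a \<bullet>c b = 0" "b \<bullet>c a = 0"
    using \<psi>0 \<psi>1 by (auto simp: a_def b_def cscalar_prod_tensor_vec cscalar_prod_basis_ket)
  have cs: "c * c + s * s = 1"
    unfolding c_def s_def of_real_mult [symmetric] of_real_add [symmetric]
    by (metis power2_eq_square of_real_1 sin_cos_squared_add2)
  have cs2: "complex_of_real (cos (2 * \<theta>)) = c * c - s * s"
    "complex_of_real (sin (2 * \<theta>)) = 2 * s * c"
    by (simp_all add: c_def s_def cos_double sin_double power2_eq_square)
  have Az: "A *\<^sub>v z = c \<cdot>\<^sub>v a + s \<cdot>\<^sub>v b"
    using A_zero by (simp add: z_def a_def b_def c_def s_def)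
  have \<phi>w: "\<phi> = mat_adjoint A *\<^sub>v w"
    using phi_def by (simp add: w_def a_def b_def c_def s_def)
  have \<phi>: "\<phi> \<in> carrier_vec ?d"
    using A' w by (simp add: \<phi>w)
  have A\<phi>: "A *\<^sub>v \<phi> = w"
    using w AA by (simp add: \<phi>w flip: assoc_mult_mat_vec [OF A A' w])
  have lin: "M *\<^sub>v (p \<cdot>\<^sub>v u + q \<cdot>\<^sub>v v) = p \<cdot>\<^sub>v (M *\<^sub>v u) + q \<cdot>\<^sub>v (M *\<^sub>v v)"
    if "M \<in> carrier_mat ?d ?d" "u \<in> carrier_vec ?d" "v \<in> carrier_vec ?d"
    for M u v and p q :: complex
    using that by (simp add: mult_add_distrib_mat_vec mult_mat_vec)
  have cancel: "mat_adjoint A *\<^sub>v (A *\<^sub>v v) = v" if "v \<in> carrier_vec ?d" for v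
    using that AA by (simp flip: assoc_mult_mat_vec [OF A' A that])
  have conj_cs: "cnj c = c" "cnj s = s"
    by (simp_all add: c_def s_def)
  \<comment> \<open>By \<open>ip\<close> only the first and last terms survive, and they
    cancel.\<close>
  have "w \<bullet>c (A *\<^sub>v z) = (- s) * c * (a \<bullet>c a) + (- s) * s * (a \<bullet>c b)
      + c * c * (b \<bullet>c a) + c * s * (b \<bullet>c b)"
    unfolding w_def Az using a b conj_cs
    by (simp add: conjugate_add_vec [of _ ?d] conjugate_smult_vec add_scalar_prod_distrib [of _ ?d]
        scalar_prod_add_distrib [of _ ?d] algebra_simps)
  then have orth: "\<phi> \<bullet>c z = 0"
    using cscalar_prod_mat_adjoint [OF A w z] ip by (simp add: \<phi>w)
  have norm: "z \<bullet>c z = 1"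
    by (simp add: z_def cscalar_prod_basis_ket)
  have U0: "U_zero n *\<^sub>v z = z" "U_zero n *\<^sub>v \<phi> = - \<phi>"
    unfolding U_zero_mult_vec [OF z] U_zero_mult_vec [OF \<phi>] z_def [symmetric] norm orth
    using z \<phi> by (auto intro!: eq_vecI)
  have Uf: "U_f n *\<^sub>v a = a" "U_f n *\<^sub>v b = - b"
    using U_f_mult_tensor_basis_ket [OF \<psi>0(1), of 0] U_f_mult_tensor_basis_ket [OF \<psi>1(1), of 1]
    by (simp_all add: a_def b_def)
  \<comment> \<open>\<open>U_f\<close> turns the coordinates \<open>(p, q)\<close> into
    \<open>(p, -q)\<close>. The new coefficients are the inner products of \<open>(p, -q)\<close>
    with \<open>(c, s)\<close> and \<open>(-s, c)\<close>, the coordinates of the images of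
    \<open>z\<close> and \<phi> under \<open>A\<close>.\<close>
  have Uf_comb: "U_f n *\<^sub>v (p \<cdot>\<^sub>v a + q \<cdot>\<^sub>v b) =
      (c * p - s * q) \<cdot>\<^sub>v (A *\<^sub>v z) + (- s * p - c * q) \<cdot>\<^sub>v (A *\<^sub>v \<phi>)" for p q
  proof -
    \<comment> \<open>Writing 1 as \<open>c * c + s * s\<close> makes the change to the rotated pair
      a polynomial identity.\<close>
    have "p = (c * c + s * s) * p" "q = (c * c + s * s) * q"
      using cs by simp_all
    then have "p = (c * p - s * q) * c + (- s * p - c * q) * (- s)"
      "- q = (c * p - s * q) * s + (- s * p - c * q) * c"
      by (simp_all add: algebra_simps)
    then have "p \<cdot>\<^sub>v a + (- q) \<cdot>\<^sub>v b =
        ((c * p - s * q) * c + (- s * p - c * q) * (- s)) \<cdot>\<^sub>v a +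
        ((c * p - s * q) * s + (- s * p - c * q) * c) \<cdot>\<^sub>v b"
      by metis
    moreover have "U_f n *\<^sub>v (p \<cdot>\<^sub>v a + q \<cdot>\<^sub>v b) = p \<cdot>\<^sub>v a + (- q) \<cdot>\<^sub>v b"
      unfolding lin [OF U_f_carrier a b] Uf using a b by (auto intro!: eq_vecI)
    ultimately show ?thesis
      unfolding A\<phi> Az w_def using a b by (auto intro!: eq_vecI simp: algebra_simps)
  qed
  have Q: "Q \<in> carrier_mat ?d ?d"
    unfolding Q_def by (rule mult_carrier_mat U_zero_carrier U_f_carrier A A')+
  \<comment> \<open>The coordinates of \<open>A *\<^sub>v v\<close> determine
    \<open>Q *\<^sub>v v\<close>. Taking \<open>(c, s)\<close> for \<open>z\<close> and
    \<open>(-s, c)\<close> for \<phi> yields the double-angle coefficients.\<close>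
  have Q_mult: "Q *\<^sub>v v = (c * p - s * q) \<cdot>\<^sub>v z + (s * p + c * q) \<cdot>\<^sub>v \<phi>"
    if v: "v \<in> carrier_vec ?d" and Av: "A *\<^sub>v v = p \<cdot>\<^sub>v a + q \<cdot>\<^sub>v b" for v p q
  proof -
    have U0A: "U_zero n * mat_adjoint A \<in> carrier_mat ?d ?d"
      by (rule mult_carrier_mat U_zero_carrier A')+
    have "Q *\<^sub>v v = (U_zero n * mat_adjoint A * U_f n) *\<^sub>v (A *\<^sub>v v)"
      unfolding Q_def
      by (rule assoc_mult_mat_vec [OF mult_carrier_mat [OF U0A U_f_carrier] A v])
    also have "\<dots> = (U_zero n * mat_adjoint A) *\<^sub>v (U_f n *\<^sub>v (A *\<^sub>v v))"
      by (rule assoc_mult_mat_vec [OF U0A U_f_carrier mult_mat_vec_carrier [OF A v]])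
    also have "\<dots> = U_zero n *\<^sub>v (mat_adjoint A *\<^sub>v (U_f n *\<^sub>v (A *\<^sub>v v)))"
      by (rule assoc_mult_mat_vec [OF U_zero_carrier A'
            mult_mat_vec_carrier [OF U_f_carrier mult_mat_vec_carrier [OF A v]]])
    also have "mat_adjoint A *\<^sub>v (U_f n *\<^sub>v (A *\<^sub>v v)) =
        (c * p - s * q) \<cdot>\<^sub>v z + (- s * p - c * q) \<cdot>\<^sub>v \<phi>"
      unfolding Av Uf_comb
      by (subst lin [OF A' mult_mat_vec_carrier [OF A z] mult_mat_vec_carrier [OF A \<phi>]])
        (simp only: cancel [OF z] cancel [OF \<phi>])
    \<comment> \<open>\<open>U_zero\<close> fixes \<open>z\<close> and negates \<phi>, which flips
      the sign of the second coefficient.\<close>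
    also have "U_zero n *\<^sub>v \<dots> = (c * p - s * q) \<cdot>\<^sub>v z + (s * p + c * q) \<cdot>\<^sub>v \<phi>"
      unfolding lin [OF U_zero_carrier z \<phi>] U0 using z \<phi>
      by (auto intro!: eq_vecI simp: algebra_simps)
    finally show ?thesis .
  qed
  have Qz: "Q *\<^sub>v z =
      complex_of_real (cos (2 * \<theta>)) \<cdot>\<^sub>v z + complex_of_real (sin (2 * \<theta>)) \<cdot>\<^sub>v \<phi>"
    unfolding Q_mult [OF z Az] cs2 by (simp add: algebra_simps)
  have Q\<phi>: "Q *\<^sub>v \<phi> =
      complex_of_real (- sin (2 * \<theta>)) \<cdot>\<^sub>v z + complex_of_real (cos (2 * \<theta>)) \<cdot>\<^sub>v \<phi>"
    unfolding Q_mult [OF \<phi> A\<phi> [unfolded w_def]] of_real_minus cs2 by (simp add: algebra_simps)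
  have "(Q ^\<^sub>m m) *\<^sub>v z = complex_of_real (cos (2 * real m * \<theta>)) \<cdot>\<^sub>v z +
      complex_of_real (sin (2 * real m * \<theta>)) \<cdot>\<^sub>v \<phi>" for m
    using rotation_pow_mat_mult_vec [OF Q z \<phi> Qz Q\<phi>, of m] by (simp add: mult_ac)
  \<comment> \<open>The formula \<open>Qz\<close>, solved for \<phi>.\<close>
  moreover have "\<phi> = complex_of_real (1 / sin (2 * \<theta>)) \<cdot>\<^sub>v
      ((Q - complex_of_real (cos (2 * \<theta>)) \<cdot>\<^sub>m id_op (n + 1)) *\<^sub>v z)" if "sin (2 * \<theta>) \<noteq> 0"
  proof -
    have "(complex_of_real (cos (2 * \<theta>)) \<cdot>\<^sub>m id_op (n + 1)) *\<^sub>v z =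
        complex_of_real (cos (2 * \<theta>)) \<cdot>\<^sub>v z"
      using z by (intro eq_vecI) (auto simp: id_op_def)
    then have "(Q - complex_of_real (cos (2 * \<theta>)) \<cdot>\<^sub>m id_op (n + 1)) *\<^sub>v z =
        Q *\<^sub>v z - complex_of_real (cos (2 * \<theta>)) \<cdot>\<^sub>v z"
      using Q z by (subst minus_mult_distrib_mat_vec) (auto simp: id_op_def)
    also have "\<dots> = complex_of_real (sin (2 * \<theta>)) \<cdot>\<^sub>v \<phi>"
      unfolding Qz using z \<phi> by (auto intro!: eq_vecI)
    finally show ?thesis
      using that \<phi> by (simp add: smult_smult_assoc flip: of_real_mult)
  qed
  ultimately show ?thesis
    by (simp add: z_def)
qed

end
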